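(* Let $0\le a<b$, $\alpha>0$, $\rho>0$. Let $f:[a,b]\to\mathbb{R}$ be a differentiable mapping on $(a,b)$, with one-sided derivatives $f'(a)$, $f'(b)$ at the endpoints, and with $f'\in L[a,b]$. Put $F(x)=f(x)+f(a+b-x)$ for $x\in[a,b]$. Then $F$ is also differentiable and $F'\in L[a,b]$. If $|f'|$ is convex on $[a,b]$ and $g:[a,b]\to\mathbb{R}$ is continuous, then $$ \left| \frac{F(a)+F(b)}{2}\left[ {}^\rho I^\alpha_{a+}g(b)+{}^\rho I^\alpha_{b-}g(a)\right] -\left[ {}^\rho I^\alpha_{a+}(gF)(b)+{}^\rho I^\alpha_{b-}(gF)(a)\right] \right| \leq \frac{(b-a) \|g\|_\infty}{\rho^\alpha \Gamma(\alpha+1)}\big( |f'(a)| + |f'(b)|\big)\int_0^1 |K(t)|\,dt, $$ where $\|g\|_\infty = \sup_{x\in [a, b]} |g(x)|$ and $K(t) = [((1-t)a + bt)^\rho - a^\rho]^\alpha - [b^\rho-((1-t)a + bt)^\rho]^\alpha$.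
   Context: The left- and right-sided Katugampola fractional integrals of order $\alpha>0$ with parameter $\rho>0$ are $$ {}^\rho I^\alpha_{a+}h(x)=\frac{\rho^{1-\alpha}}{\Gamma(\alpha)}\int_a^x\frac{t^{\rho-1}}{(x^\rho-t^\rho)^{1-\alpha}}h(t)\,dt,\qquad {}^\rho I^\alpha_{b-}h(x)=\frac{\rho^{1-\alpha}}{\Gamma(\alpha)}\int_x^b\frac{t^{\rho-1}}{(t^\rho-x^\rho)^{1-\alpha}}h(t)\,dt,$$ when the integrals exist; ${}^\rho I^\alpha_{a+}h(b)$ and ${}^\rho I^\alpha_{b-}h(a)$ denote their values at $x=b$ and $x=a$ respectively. $gF$ is the pointwise product. $\Gamma$ is Euler's gamma function and $L[a,b]$ is the space of Lebesgue integrable functions on $[a,b]$. *)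

theory Defs
  imports "HOL-Analysis.Analysis"
begin

text \<open>
  Katugampola fractional integrals. The conventions \<open>0 powr s = 0\<close> and \<open>u / 0 = 0\<close> affect the
  integrands at most at the end points of the interval, that is, on a null set.
\<close>

definition katugampola_left_integrand ::
    "real \<Rightarrow> real \<Rightarrow> (real \<Rightarrow> real) \<Rightarrow> real \<Rightarrow> real \<Rightarrow> real" where
  "katugampola_left_integrand \<rho> \<alpha> h x t =
     t powr (\<rho> - 1) / (x powr \<rho> - t powr \<rho>) powr (1 - \<alpha>) * h t"

definition katugampola_right_integrand ::
    "real \<Rightarrow> real \<Rightarrow> (real \<Rightarrow> real) \<Rightarrow> real \<Rightarrow> real \<Rightarrow> real" where
  "katugampola_right_integrand \<rho> \<alpha> h x t =
     t powr (\<rho> - 1) / (t powr \<rho> - x powr \<rho>) powr (1 - \<alpha>) * h t"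

definition katugampola_left_exists ::
    "real \<Rightarrow> real \<Rightarrow> real \<Rightarrow> (real \<Rightarrow> real) \<Rightarrow> real \<Rightarrow> bool" where
  "katugampola_left_exists \<rho> \<alpha> a h x \<longleftrightarrow>
     set_integrable lebesgue {a..x} (katugampola_left_integrand \<rho> \<alpha> h x)"

definition katugampola_right_exists ::
    "real \<Rightarrow> real \<Rightarrow> real \<Rightarrow> (real \<Rightarrow> real) \<Rightarrow> real \<Rightarrow> bool" where
  "katugampola_right_exists \<rho> \<alpha> b h x \<longleftrightarrow>
     set_integrable lebesgue {x..b} (katugampola_right_integrand \<rho> \<alpha> h x)"

text \<open>
  The two integrals below are meaningful only for \<open>0 \<le> a \<le> x\<close>, respectively \<open>0 \<le> x \<le> b\<close>, and if
  the corresponding predicate above holds.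
\<close>

definition katugampola_left ::
    "real \<Rightarrow> real \<Rightarrow> real \<Rightarrow> (real \<Rightarrow> real) \<Rightarrow> real \<Rightarrow> real" where
  "katugampola_left \<rho> \<alpha> a h x =
     \<rho> powr (1 - \<alpha>) / Gamma \<alpha> * (LINT t:{a..x}|lebesgue. katugampola_left_integrand \<rho> \<alpha> h x t)"

definition katugampola_right ::
    "real \<Rightarrow> real \<Rightarrow> real \<Rightarrow> (real \<Rightarrow> real) \<Rightarrow> real \<Rightarrow> real" where
  "katugampola_right \<rho> \<alpha> b h x =
     \<rho> powr (1 - \<alpha>) / Gamma \<alpha> * (LINT t:{x..b}|lebesgue. katugampola_right_integrand \<rho> \<alpha> h x t)"

end

theory Submission
  imports Defs
begin

text \<open>
  The kernel \<open>t\<^sup>\<rho>\<^sup>-\<^sup>1 ((b\<^sup>\<rho> - t\<^sup>\<rho>)\<^sup>\<alpha>\<^sup>-\<^sup>1 + (t\<^sup>\<rho> - a\<^sup>\<rho>)\<^sup>\<alpha>\<^sup>-\<^sup>1)\<close> occurring in the sum of the two fractional integrals is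
  \<open>\<Phi>' / (\<alpha> \<rho>)\<close> for \<open>\<Phi> x = (x\<^sup>\<rho> - a\<^sup>\<rho>)\<^sup>\<alpha> - (b\<^sup>\<rho> - x\<^sup>\<rho>)\<^sup>\<alpha>\<close>. As \<open>F\<close> is symmetric about the midpoint
  and \<open>\<bar>F'\<bar> \<le> M = \<bar>f' a\<bar> + \<bar>f' b\<bar>\<close> by convexity, \<open>\<bar>F a - F t\<bar> \<le> M * min (t - a) (b - t)\<close>.
  Integrating \<open>\<Phi>'\<close> by parts against this tent function on both halves of the interval
  leaves at most \<open>M \<integral> \<bar>\<Phi>\<bar>\<close>, and \<open>\<Phi>\<close> is \<open>K\<close> up to an affine substitution.
\<close>

section \<open>Integration against a nonnegative derivative\<close>

text \<open>The derivative may be unbounded near the end points, as the kernels are for \<alpha> <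
  1. The fundamental theorem with derivatives in the interior only still gives gauge integrability,
  and nonnegativity upgrades it to absolute integrability.\<close>

lemma deriv_nonneg_absolutely_integrable:
  fixes \<Phi> \<phi> :: "real \<Rightarrow> real"
  assumes "a \<le> b" "continuous_on {a..b} \<Phi>"
    and "\<And>x. x \<in> {a<..<b} \<Longrightarrow> (\<Phi> has_real_derivative \<phi> x) (at x)"
    and "\<And>x. x \<in> {a..b} \<Longrightarrow> 0 \<le> \<phi> x"
  shows "\<phi> absolutely_integrable_on {a..b}"
proof (rule nonnegative_absolutely_integrable_1)
  show "\<phi> integrable_on {a..b}"
    using fundamental_theorem_of_calculus_interior[of a b \<Phi> \<phi>] assms
    by (auto simp: has_real_derivative_iff_has_vector_derivative integrable_on_def)
qed (use assms in auto)

text \<open>Integration by parts with a free base point \<open>p\<close>. Putting \<open>p\<close>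
  at an end of the interval makes the boundary term there vanish.\<close>

lemma has_integral_deriv_mult_linear:
  fixes \<Phi> \<phi> :: "real \<Rightarrow> real"
  assumes "a \<le> b" and cont: "continuous_on {a..b} \<Phi>"
    and "\<And>x. x \<in> {a<..<b} \<Longrightarrow> (\<Phi> has_real_derivative \<phi> x) (at x)"
  shows "((\<lambda>t. \<phi> t * (t - p)) has_integral
           \<Phi> b * (b - p) - \<Phi> a * (a - p) - integral {a..b} \<Phi>) {a..b}"
proof (rule integration_by_parts_interior[where prod = "(*)" and f = \<Phi> and g' = "\<lambda>_. 1"])
  show "((\<lambda>x. \<Phi> x * 1) has_integral \<Phi> b * (b - p) - \<Phi> a * (a - p)
          - (\<Phi> b * (b - p) - \<Phi> a * (a - p) - integral {a..b} \<Phi>)) {a..b}"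
    using integrable_continuous_real[OF cont] by (simp add: has_integral_integral)
qed (use assms in \<open>auto intro!: continuous_intros bounded_bilinear_mult derivative_eq_intros
       simp flip: has_real_derivative_iff_has_vector_derivative\<close>)

lemma absolutely_integrable_mult_continuous:
  fixes w u :: "real \<Rightarrow> real"
  assumes "w absolutely_integrable_on {a..b}" "continuous_on {a..b} u"
  shows "(\<lambda>t. w t * u t) absolutely_integrable_on {a..b}"
  using absolutely_integrable_bounded_measurable_product_real[of u "{a..b}" w] assms
    compact_imp_bounded[OF compact_continuous_image[OF assms(2)]]
  by (simp add: mult.commute continuous_imp_measurable_on_sets_lebesgue)

text \<open>The interval is cut at its midpoint, where the two linear bounds on \<open>u\<close>
  have the same value. This makes the boundary terms of the two integrations by parts cancel,
  whatever the value of \<Phi> there.\<close>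

lemma abs_integral_deriv_mult_le:
  fixes \<Phi> \<phi> u :: "real \<Rightarrow> real"
  assumes ab: "a \<le> b" and cont: "continuous_on {a..b} \<Phi>"
    and der: "\<And>x. x \<in> {a<..<b} \<Longrightarrow> (\<Phi> has_real_derivative \<phi> x) (at x)"
    and nonneg: "\<And>x. x \<in> {a..b} \<Longrightarrow> 0 \<le> \<phi> x"
    and contu: "continuous_on {a..b} u" and M: "0 \<le> M"
    and ua: "\<And>t. t \<in> {a..b} \<Longrightarrow> \<bar>u t\<bar> \<le> M * (t - a)"
    and ub: "\<And>t. t \<in> {a..b} \<Longrightarrow> \<bar>u t\<bar> \<le> M * (b - t)"
  shows "\<bar>integral {a..b} (\<lambda>t. \<phi> t * u t)\<bar> \<le> M * integral {a..b} (\<lambda>t. \<bar>\<Phi> t\<bar>)"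
proof -
  define c where "c = (a + b) / 2"
  have c: "a \<le> c" "c \<le> b" "c - a = b - c" using ab by (auto simp: c_def field_simps)
  have int: "(\<lambda>t. \<phi> t * u t) integrable_on {a..b}"
    using deriv_nonneg_absolutely_integrable[OF ab cont der nonneg] contu
    by (blast intro: absolutely_integrable_mult_continuous set_lebesgue_integral_eq_integral(1))
  have cont1: "continuous_on {a..c} \<Phi>" and cont2: "continuous_on {c..b} \<Phi>"
    by (rule continuous_on_subset[OF cont]; use c in auto)+
  have int1: "(\<lambda>t. \<phi> t * u t) integrable_on {a..c}"
    and int2: "(\<lambda>t. \<phi> t * u t) integrable_on {c..b}"
    by (rule integrable_subinterval_real[OF int]; use c in auto)+
  have half1: "((\<lambda>t. M * (\<phi> t * (t - a))) has_integral
      M * (\<Phi> c * (c - a) - integral {a..c} \<Phi>)) {a..c}"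
    using has_integral_deriv_mult_linear[of a c \<Phi> \<phi> a] cont1 c der
    by (intro has_integral_mult_right) auto
  \<comment> \<open>The bound \<open>M * (b - t)\<close> is written as
    \<open>(- M) * (t - b)\<close>, so that the same integration by parts applies with base point
    \<open>b\<close>. Only the boundary term at \<open>c\<close> survives.\<close>
  have half2: "((\<lambda>t. (- M) * (\<phi> t * (t - b))) has_integral
      (- M) * (- \<Phi> c * (c - b) - integral {c..b} \<Phi>)) {c..b}"
    using has_integral_deriv_mult_linear[of c b \<Phi> \<phi> b] cont2 c der
    by (intro has_integral_mult_right) auto
  have "norm (integral {a..c} (\<lambda>t. \<phi> t * u t)) \<le> integral {a..c} (\<lambda>t. M * (\<phi> t * (t - a)))"
  proof (rule integral_norm_bound_integral[OF int1 has_integral_integrable[OF half1]])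
    fix t assume "t \<in> {a..c}"
    then have t: "t \<in> {a..b}" using c by auto
    show "norm (\<phi> t * u t) \<le> M * (\<phi> t * (t - a))"
      using mult_left_mono[OF ua[OF t] nonneg[OF t]] nonneg[OF t] by (simp add: abs_mult mult_ac)
  qed
  then have 1: "\<bar>integral {a..c} (\<lambda>t. \<phi> t * u t)\<bar> \<le> M * (\<Phi> c * (c - a) - integral {a..c} \<Phi>)"
    unfolding integral_unique[OF half1] real_norm_def .
  have "norm (integral {c..b} (\<lambda>t. \<phi> t * u t)) \<le> integral {c..b} (\<lambda>t. (- M) * (\<phi> t * (t - b)))"
  proof (rule integral_norm_bound_integral[OF int2 has_integral_integrable[OF half2]])
    fix t assume "t \<in> {c..b}"
    then have t: "t \<in> {a..b}" using c by auto
    show "norm (\<phi> t * u t) \<le> (- M) * (\<phi> t * (t - b))"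
      using mult_left_mono[OF ub[OF t] nonneg[OF t]] nonneg[OF t]
      by (simp add: abs_mult algebra_simps)
  qed
  then have 2: "\<bar>integral {c..b} (\<lambda>t. \<phi> t * u t)\<bar> \<le> - M * (- \<Phi> c * (c - b) - integral {c..b} \<Phi>)"
    unfolding integral_unique[OF half2] real_norm_def .
  have abs1: "- integral {a..c} \<Phi> \<le> integral {a..c} (\<lambda>t. \<bar>\<Phi> t\<bar>)"
    using integral_norm_bound_integral[of \<Phi> "{a..c}" "\<lambda>t. \<bar>\<Phi> t\<bar>"] cont1
    by (force intro: integrable_continuous_real continuous_intros)
  have abs2: "integral {c..b} \<Phi> \<le> integral {c..b} (\<lambda>t. \<bar>\<Phi> t\<bar>)"
    using integral_norm_bound_integral[of \<Phi> "{c..b}" "\<lambda>t. \<bar>\<Phi> t\<bar>"] cont2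
    by (force intro: integrable_continuous_real continuous_intros)
  have "\<bar>integral {a..b} (\<lambda>t. \<phi> t * u t)\<bar>
      \<le> M * (\<Phi> c * (c - a) - integral {a..c} \<Phi>) + - M * (- \<Phi> c * (c - b) - integral {c..b} \<Phi>)"
    using 1 2 Henstock_Kurzweil_Integration.integral_combine[OF c(1,2) int] by linarith
  \<comment> \<open>The terms with \<open>\<Phi> c\<close> cancel because
    \<open>c - a = b - c\<close>.\<close>
  also have "\<dots> = M * (- integral {a..c} \<Phi> + integral {c..b} \<Phi>)"
  proof -
    have "c - b = - (c - a)" using c(3) by simp
    then show ?thesis by (simp only:) (simp add: algebra_simps)
  qed
  also have "\<dots> \<le> M * (integral {a..c} (\<lambda>t. \<bar>\<Phi> t\<bar>) + integral {c..b} (\<lambda>t. \<bar>\<Phi> t\<bar>))"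
    using abs1 abs2 M by (intro mult_left_mono add_mono)
  also have "\<dots> = M * integral {a..b} (\<lambda>t. \<bar>\<Phi> t\<bar>)"
    using Henstock_Kurzweil_Integration.integral_combine[OF c(1,2), of "\<lambda>t. \<bar>\<Phi> t\<bar>"] cont
    by (simp add: integrable_continuous_real continuous_intros)
  finally show ?thesis .
qed

section \<open>Reflection, affine substitution and convexity\<close>

text \<open>Gauge integrability is preserved by the affine map with slope -1. Applying this to
  \<open>h\<close> and to its absolute value recovers absolute integrability.\<close>

lemma absolutely_integrable_reflect_sum:
  fixes h :: "real \<Rightarrow> real"
  assumes "h absolutely_integrable_on {a..b}"
  shows "(\<lambda>x. h (a + b - x)) absolutely_integrable_on {a..b}"
proof -
  have *: "(\<lambda>x. k (a + b - x)) integrable_on {a..b}" if "k integrable_on {a..b}"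
    for k :: "real \<Rightarrow> real"
    using integrable_affinity[of k a b "-1" "a + b"] that by (simp add: algebra_simps)
  show ?thesis
    using *[OF set_lebesgue_integral_eq_integral(1)[OF assms]]
      *[OF set_lebesgue_integral_eq_integral(1)[OF set_integrable_abs[OF assms]]]
    by (rule abs_absolutely_integrableI_1)
qed

text \<open>Converts the integral of |K| over the unit interval into that of |\<Phi>|; the Jacobian
  is the factor \<open>b - a\<close> of the final bound.\<close>

lemma integral_affine_unit_interval:
  fixes h :: "real \<Rightarrow> real"
  assumes "a < b" "continuous_on {a..b} h"
  shows "(b - a) * integral {0..1} (\<lambda>t. h ((1 - t) * a + b * t)) = integral {a..b} h"
proof -
  have "(h has_integral integral {a..b} h) (cbox a b)"
    using integrable_continuous_real[OF assms(2)] by (simp add: has_integral_integral)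
  from has_integral_affinity'[OF this, of "b - a" a]
  have "((\<lambda>t. h ((b - a) * t + a)) has_integral integral {a..b} h / (b - a)) {0..1}"
    using assms(1) by (simp add: divide_inverse mult.commute)
  moreover have "(\<lambda>t. h ((b - a) * t + a)) = (\<lambda>t. h ((1 - t) * a + b * t))"
    by (simp add: algebra_simps)
  ultimately show ?thesis using assms(1) by (simp add: integral_unique)
qed

text \<open>A point and its reflection are convex combinations of the end points with the weights
  swapped, so the two chord bounds add up to the end point values. The case \<open>a = b\<close> is
  separate because the weight \<open>l\<close> divides by \<open>b - a\<close>.\<close>

lemma convex_on_le_endpoints_reflect:
  fixes h :: "real \<Rightarrow> real"
  assumes "convex_on {a..b} h" "x \<in> {a..b}"
  shows "h x + h (a + b - x) \<le> h a + h b"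
proof (cases "a = b")
  case False
  then have ab: "a < b" using assms by auto
  define l where "l = (x - a) / (b - a)"
  have l: "0 \<le> l" "l \<le> 1" using assms ab by (auto simp: l_def field_simps)
  have lx: "l * (b - a) = x - a" using ab by (simp add: l_def)
  have x: "x = (1 - l) * a + l * b" using lx by (simp add: algebra_simps)
  \<comment> \<open>The unsimplified \<open>1 - (1 - l)\<close> matches the shape of
    \<open>convex_onD\<close> at parameter \<open>1 - l\<close>.\<close>
  have y: "a + b - x = (1 - (1 - l)) * a + (1 - l) * b" using x by (simp add: algebra_simps)
  have "h x \<le> (1 - l) * h a + l * h b"
    unfolding x using convex_onD[OF assms(1), of l a b] l ab by simp
  moreover have "h (a + b - x) \<le> (1 - (1 - l)) * h a + (1 - l) * h b"
    unfolding y using convex_onD[OF assms(1), of "1 - l" a b] l ab by simp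
  ultimately show ?thesis by (simp add: algebra_simps)
qed (use assms in auto)

section \<open>Primitives of the Katugampola kernels\<close>

text \<open>A positive exponent keeps the power continuous where its base reaches 0, which happens
  at an end point for both primitives.\<close>

lemma continuous_on_powr_diff:
  fixes u v :: "real \<Rightarrow> real"
  assumes "continuous_on S u" "continuous_on S v" "\<And>x. x \<in> S \<Longrightarrow> v x \<le> u x" "0 < \<alpha>"
  shows "continuous_on S (\<lambda>x. (u x - v x) powr \<alpha>)"
  using assms by (intro continuous_on_powr' continuous_intros) auto

context
  fixes a b \<alpha> \<rho> :: real
  assumes a: "0 \<le> a" and ab: "a < b" and \<alpha>: "0 < \<alpha>" and \<rho>: "0 < \<rho>"
begin

lemma continuous_on_left_primitive:
  "continuous_on {a..b} (\<lambda>x. (b powr \<rho> - x powr \<rho>) powr \<alpha>)"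
  using a \<alpha> \<rho>
  by (intro continuous_on_powr_diff continuous_on_powr' continuous_intros) (auto intro: powr_mono2)

lemma continuous_on_right_primitive:
  "continuous_on {a..b} (\<lambda>x. (x powr \<rho> - a powr \<rho>) powr \<alpha>)"
  using a \<alpha> \<rho>
  by (intro continuous_on_powr_diff continuous_on_powr' continuous_intros) (auto intro: powr_mono2)

text \<open>The minus sign makes the primitive increasing; taking the constant function 1 for
  \<open>h\<close> leaves the bare kernel.\<close>

lemma left_primitive_deriv:
  assumes "x \<in> {a<..<b}"
  shows "((\<lambda>x. - ((b powr \<rho> - x powr \<rho>) powr \<alpha>)) has_real_derivative
           \<alpha> * \<rho> * katugampola_left_integrand \<rho> \<alpha> (\<lambda>_. 1) b x) (at x)"
proof -
  \<comment> \<open>An interior point is strictly positive even if \<open>a = 0\<close>, so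
    \<open>x powr \<rho>\<close> is differentiable there.\<close>
  have x: "0 < x" "x < b" using assms a by auto
  then have pos: "0 < b powr \<rho> - x powr \<rho>" using \<rho> by (simp add: powr_less_mono2)
  have "(b powr \<rho> - x powr \<rho>) powr (\<alpha> - 1) = 1 / (b powr \<rho> - x powr \<rho>) powr (1 - \<alpha>)"
    by (metis minus_diff_eq powr_minus_divide)
  then show ?thesis
    using x pos unfolding katugampola_left_integrand_def
    by (auto intro!: derivative_eq_intros)
qed

lemma right_primitive_deriv:
  assumes "x \<in> {a<..<b}"
  shows "((\<lambda>x. (x powr \<rho> - a powr \<rho>) powr \<alpha>) has_real_derivative
           \<alpha> * \<rho> * katugampola_right_integrand \<rho> \<alpha> (\<lambda>_. 1) a x) (at x)"
proof -
  have x: "0 < x" "a < x" using assms a by auto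
  then have pos: "0 < x powr \<rho> - a powr \<rho>" using a \<rho> by (simp add: powr_less_mono2)
  have "(x powr \<rho> - a powr \<rho>) powr (\<alpha> - 1) = 1 / (x powr \<rho> - a powr \<rho>) powr (1 - \<alpha>)"
    by (metis minus_diff_eq powr_minus_divide)
  then show ?thesis
    using x pos unfolding katugampola_right_integrand_def
    by (auto intro!: derivative_eq_intros)
qed

text \<open>The bare kernel is integrable, being a nonnegative derivative up to the factor
  \<open>\<alpha> * \<rho>\<close>. The continuous \<open>h\<close> then enters as a bounded
  measurable factor.\<close>

lemma katugampola_left_exists_continuous:
  assumes "continuous_on {a..b} h"
  shows "katugampola_left_exists \<rho> \<alpha> a h b"
proof -
  have "(\<lambda>x. \<alpha> * \<rho> * katugampola_left_integrand \<rho> \<alpha> (\<lambda>_. 1) b x) absolutely_integrable_on {a..b}"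
    using ab \<alpha> \<rho> left_primitive_deriv continuous_on_left_primitive
    by (intro deriv_nonneg_absolutely_integrable[where \<Phi> = "\<lambda>x. - ((b powr \<rho> - x powr \<rho>) powr \<alpha>)"])
       (auto intro!: continuous_intros simp: katugampola_left_integrand_def)
  then have "katugampola_left_integrand \<rho> \<alpha> (\<lambda>_. 1) b absolutely_integrable_on {a..b}"
    using \<alpha> \<rho> by simp
  from absolutely_integrable_mult_continuous[OF this assms]
  show ?thesis
    by (simp add: katugampola_left_exists_def katugampola_left_integrand_def[abs_def])
qed

lemma katugampola_right_exists_continuous:
  assumes "continuous_on {a..b} h"
  shows "katugampola_right_exists \<rho> \<alpha> b h a"
proof -
  have "(\<lambda>x. \<alpha> * \<rho> * katugampola_right_integrand \<rho> \<alpha> (\<lambda>_. 1) a x) absolutely_integrable_on {a..b}"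
    using ab \<alpha> \<rho> right_primitive_deriv continuous_on_right_primitive
    by (intro deriv_nonneg_absolutely_integrable[where \<Phi> = "\<lambda>x. (x powr \<rho> - a powr \<rho>) powr \<alpha>"])
       (auto simp: katugampola_right_integrand_def)
  then have "katugampola_right_integrand \<rho> \<alpha> (\<lambda>_. 1) a absolutely_integrable_on {a..b}"
    using \<alpha> \<rho> by simp
  from absolutely_integrable_mult_continuous[OF this assms]
  show ?thesis
    by (simp add: katugampola_right_exists_def katugampola_right_integrand_def[abs_def])
qed

text \<open>Merges both fractional integrals into one gauge integral whose weight is, up to the
  factor \<open>\<alpha> * \<rho>\<close>, the derivative of \<Phi>. The integration by parts can
  then be applied to it.\<close>

lemma katugampola_sum_eq:
  assumes "continuous_on {a..b} h"
  shows "katugampola_left \<rho> \<alpha> a h b + katugampola_right \<rho> \<alpha> b h a =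
    \<rho> powr (1 - \<alpha>) / Gamma \<alpha> *
      integral {a..b} (\<lambda>t. (katugampola_left_integrand \<rho> \<alpha> (\<lambda>_. 1) b t
                           + katugampola_right_integrand \<rho> \<alpha> (\<lambda>_. 1) a t) * h t)"
proof -
  note l = set_lebesgue_integral_eq_integral[OF katugampola_left_exists_continuous
      [OF assms, unfolded katugampola_left_exists_def]]
  note r = set_lebesgue_integral_eq_integral[OF katugampola_right_exists_continuous
      [OF assms, unfolded katugampola_right_exists_def]]
  have "(\<lambda>t. (katugampola_left_integrand \<rho> \<alpha> (\<lambda>_. 1) b t
            + katugampola_right_integrand \<rho> \<alpha> (\<lambda>_. 1) a t) * h t)
      = (\<lambda>t. katugampola_left_integrand \<rho> \<alpha> h b t + katugampola_right_integrand \<rho> \<alpha> h a t)"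
    by (simp add: katugampola_left_integrand_def[abs_def] katugampola_right_integrand_def[abs_def]
        distrib_right)
  then show ?thesis
    using Henstock_Kurzweil_Integration.integral_add[OF l(1) r(1)]
    by (simp add: katugampola_left_def katugampola_right_def l(2) r(2) distrib_left)
qed

lemma abs_katugampola_sum_le:
  fixes u :: "real \<Rightarrow> real"
  assumes contu: "continuous_on {a..b} u" and M: "0 \<le> M"
    and ua: "\<And>t. t \<in> {a..b} \<Longrightarrow> \<bar>u t\<bar> \<le> M * (t - a)"
    and ub: "\<And>t. t \<in> {a..b} \<Longrightarrow> \<bar>u t\<bar> \<le> M * (b - t)"
  shows "\<bar>katugampola_left \<rho> \<alpha> a u b + katugampola_right \<rho> \<alpha> b u a\<bar> \<le>
    M / (\<rho> powr \<alpha> * Gamma (\<alpha> + 1)) *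
      integral {a..b} (\<lambda>t. \<bar>(t powr \<rho> - a powr \<rho>) powr \<alpha> - (b powr \<rho> - t powr \<rho>) powr \<alpha>\<bar>)"
proof -
  let ?w = "\<lambda>t. katugampola_left_integrand \<rho> \<alpha> (\<lambda>_. 1) b t + katugampola_right_integrand \<rho> \<alpha> (\<lambda>_. 1) a t"
  let ?\<Phi> = "\<lambda>t. (t powr \<rho> - a powr \<rho>) powr \<alpha> - (b powr \<rho> - t powr \<rho>) powr \<alpha>"
  have "\<bar>integral {a..b} (\<lambda>t. (\<alpha> * \<rho> * ?w t) * u t)\<bar> \<le> M * integral {a..b} (\<lambda>t. \<bar>?\<Phi> t\<bar>)"
  proof (rule abs_integral_deriv_mult_le)
    show "continuous_on {a..b} ?\<Phi>"
      by (intro continuous_on_diff continuous_on_left_primitive continuous_on_right_primitive)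
    show "(?\<Phi> has_real_derivative \<alpha> * \<rho> * ?w x) (at x)" if "x \<in> {a<..<b}" for x
      using DERIV_add[OF right_primitive_deriv[OF that] left_primitive_deriv[OF that]]
      by (simp add: algebra_simps)
    show "0 \<le> \<alpha> * \<rho> * ?w x" for x
      using \<alpha> \<rho> by (simp add: katugampola_left_integrand_def katugampola_right_integrand_def)
  qed (use ab assms in auto)
  then have *: "\<alpha> * \<rho> * \<bar>integral {a..b} (\<lambda>t. ?w t * u t)\<bar> \<le> M * integral {a..b} (\<lambda>t. \<bar>?\<Phi> t\<bar>)"
    using \<alpha> \<rho> by (simp add: mult.assoc abs_mult)
  have G: "Gamma (\<alpha> + 1) = \<alpha> * Gamma \<alpha>" "0 < Gamma \<alpha>"
    using \<alpha> by (auto simp: Gamma_plus1 nonpos_Ints_def Gamma_real_pos)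
  \<comment> \<open>The factor \<open>\<alpha> * \<rho>\<close> split off here is the one that turns
    the summed kernel into the derivative of \<Phi>.\<close>
  have "\<rho> powr (1 - \<alpha>) / Gamma \<alpha> = \<alpha> * \<rho> / (\<rho> powr \<alpha> * Gamma (\<alpha> + 1))"
    using \<alpha> \<rho> G by (simp add: powr_diff field_simps)
  then have "\<bar>katugampola_left \<rho> \<alpha> a u b + katugampola_right \<rho> \<alpha> b u a\<bar>
      = (\<alpha> * \<rho> * \<bar>integral {a..b} (\<lambda>t. ?w t * u t)\<bar>) / (\<rho> powr \<alpha> * Gamma (\<alpha> + 1))"
    using \<alpha> \<rho> G by (simp add: katugampola_sum_eq[OF contu] abs_mult)
  also have "\<dots> \<le> (M * integral {a..b} (\<lambda>t. \<bar>?\<Phi> t\<bar>)) / (\<rho> powr \<alpha> * Gamma (\<alpha> + 1))"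
    using * \<alpha> \<rho> G by (intro divide_right_mono) auto
  finally show ?thesis by simp
qed

end

section \<open>Symmetrization of f and the final estimate\<close>

theorem theorem3p11:
  fixes a b \<alpha> \<rho> :: real and f f' F g K :: "real \<Rightarrow> real"
  assumes "0 \<le> a" and "a < b" and "\<alpha> > 0" and "\<rho> > 0"
    and "\<And>x. x \<in> {a..b} \<Longrightarrow> (f has_real_derivative f' x) (at x within {a..b})"
    and "set_integrable lebesgue {a..b} f'"
    and "\<And>x. x \<in> {a..b} \<Longrightarrow> F x = f x + f (a + b - x)"
    and "\<And>t. t \<in> {0..1} \<Longrightarrow>
           K t = (((1 - t) * a + b * t) powr \<rho> - a powr \<rho>) powr \<alpha>
                 - (b powr \<rho> - ((1 - t) * a + b * t) powr \<rho>) powr \<alpha>"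
  shows "(\<exists>F'. (\<forall>x\<in>{a..b}. (F has_real_derivative F' x) (at x within {a..b}))
               \<and> set_integrable lebesgue {a..b} F')
    \<and> (convex_on {a..b} (\<lambda>x. \<bar>f' x\<bar>) \<longrightarrow> continuous_on {a..b} g \<longrightarrow>
         katugampola_left_exists \<rho> \<alpha> a g b \<and> katugampola_right_exists \<rho> \<alpha> b g a
       \<and> katugampola_left_exists \<rho> \<alpha> a (\<lambda>x. g x * F x) b
       \<and> katugampola_right_exists \<rho> \<alpha> b (\<lambda>x. g x * F x) a
       \<and> \<bar>(F a + F b) / 2 * (katugampola_left \<rho> \<alpha> a g b + katugampola_right \<rho> \<alpha> b g a)
           - (katugampola_left \<rho> \<alpha> a (\<lambda>x. g x * F x) b
              + katugampola_right \<rho> \<alpha> b (\<lambda>x. g x * F x) a)\<bar>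
         \<le> (b - a) * (SUP x\<in>{a..b}. \<bar>g x\<bar>) / (\<rho> powr \<alpha> * Gamma (\<alpha> + 1))
            * (\<bar>f' a\<bar> + \<bar>f' b\<bar>) * (LINT t:{0..1}|lebesgue. \<bar>K t\<bar>))"
proof -
  define F' where "F' x = f' x - f' (a + b - x)" for x
  note a = assms(1) and ab = assms(2) and \<alpha> = assms(3) and \<rho> = assms(4)
  note der = assms(5) and int = assms(6) and F = assms(7) and K = assms(8)
  note exist = katugampola_left_exists_continuous[OF a ab \<alpha> \<rho>]
    katugampola_right_exists_continuous[OF a ab \<alpha> \<rho>]
  have derF: "(F has_real_derivative F' x) (at x within {a..b})" if x: "x \<in> {a..b}" for x
  proof -
    have y: "a + b - x \<in> {a..b}" using x by auto
    \<comment> \<open>The chain rule for derivatives within a set works on the image of that set; as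
      the reflection preserves the interval, the one-sided derivatives at the end points are covered
      too.\<close>
    have "(\<lambda>x. a + b - x) ` {a..b} = {a..b}" by simp
    then have fa: "(f has_real_derivative f' (a + b - x)) (at (a + b - x) within (\<lambda>x. a + b - x) ` {a..b})"
      using der[OF y] by simp
    moreover have "((\<lambda>x. a + b - x) has_real_derivative - 1) (at x within {a..b})"
      by (auto intro!: derivative_eq_intros)
    from DERIV_image_chain[OF fa this]
    have "((\<lambda>x. f (a + b - x)) has_real_derivative - f' (a + b - x)) (at x within {a..b})"
      by (simp add: o_def)
    from DERIV_add[OF der[OF x] this]
    have "((\<lambda>x. f x + f (a + b - x)) has_real_derivative F' x) (at x within {a..b})"
      by (simp add: F'_def)
    \<comment> \<open>\<open>F\<close> is prescribed only on the interval, hence the transfer within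
      it. The radius 1 is arbitrary.\<close>
    then show ?thesis
      by (rule has_field_derivative_transform_within[OF _ zero_less_one x]) (use F in auto)
  qed
  have intF': "set_integrable lebesgue {a..b} F'"
    unfolding F'_def by (intro set_integral_diff int absolutely_integrable_reflect_sum)
  have contF: "continuous_on {a..b} F"
    using derF DERIV_continuous_on by blast
  have "katugampola_left_exists \<rho> \<alpha> a g b \<and> katugampola_right_exists \<rho> \<alpha> b g a
       \<and> katugampola_left_exists \<rho> \<alpha> a (\<lambda>x. g x * F x) b
       \<and> katugampola_right_exists \<rho> \<alpha> b (\<lambda>x. g x * F x) a
       \<and> \<bar>(F a + F b) / 2 * (katugampola_left \<rho> \<alpha> a g b + katugampola_right \<rho> \<alpha> b g a)
           - (katugampola_left \<rho> \<alpha> a (\<lambda>x. g x * F x) b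
              + katugampola_right \<rho> \<alpha> b (\<lambda>x. g x * F x) a)\<bar>
         \<le> (b - a) * (SUP x\<in>{a..b}. \<bar>g x\<bar>) / (\<rho> powr \<alpha> * Gamma (\<alpha> + 1))
            * (\<bar>f' a\<bar> + \<bar>f' b\<bar>) * (LINT t:{0..1}|lebesgue. \<bar>K t\<bar>)"
    if conv: "convex_on {a..b} (\<lambda>x. \<bar>f' x\<bar>)" and contg: "continuous_on {a..b} g"
  proof (intro conjI exist contg continuous_on_mult contF)
    let ?\<Phi> = "\<lambda>t. (t powr \<rho> - a powr \<rho>) powr \<alpha> - (b powr \<rho> - t powr \<rho>) powr \<alpha>"
    define M where "M = \<bar>f' a\<bar> + \<bar>f' b\<bar>"
    define G where "G = (SUP x\<in>{a..b}. \<bar>g x\<bar>)"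
    \<comment> \<open>Since \<open>F b = F a\<close>, the mean of the end point values is
      \<open>F a\<close>. The difference to be estimated is therefore the sum of the fractional
      integrals of this \<open>u\<close>, which vanishes at both ends.\<close>
    define u where "u t = g t * (F a - F t)" for t
    have contu: "continuous_on {a..b} u"
      unfolding u_def by (intro continuous_intros contg contF)
    \<comment> \<open>Compactness makes the supremum finite, so that \<open>G\<close> really bounds
      |g|.\<close>
    have "compact ((\<lambda>x. \<bar>g x\<bar>) ` {a..b})"
      by (intro compact_continuous_image continuous_intros contg) simp
    then have gG: "\<bar>g t\<bar> \<le> G" if "t \<in> {a..b}" for t
      unfolding G_def using that
      by (intro cSUP_upper) (auto intro: bounded_imp_bdd_above compact_imp_bounded)
    have G0: "0 \<le> G" using gG[of a] ab by auto
    have Fab: "F b = F a" using F[of a] F[of b] ab by simp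
    have "\<bar>F' x\<bar> \<le> M" if "x \<in> {a..b}" for x
      using convex_on_le_endpoints_reflect[OF conv that] unfolding F'_def M_def by linarith
    then have Fdiff: "\<bar>F x - F y\<bar> \<le> M * \<bar>x - y\<bar>" if "x \<in> {a..b}" "y \<in> {a..b}" for x y
      using field_differentiable_bound[OF convex_real_interval(5) derF _ that, where B = M] by simp
    have ua: "\<bar>u t\<bar> \<le> (G * M) * (t - a)" if t: "t \<in> {a..b}" for t
      using mult_mono[OF gG[OF t] Fdiff[of a t]] G0 t
      by (simp add: u_def abs_mult mult.assoc)
    \<comment> \<open>Replacing \<open>F a\<close> by \<open>F b\<close> lets the Lipschitz bound be
      measured from the right end.\<close>
    have ub: "\<bar>u t\<bar> \<le> (G * M) * (b - t)" if t: "t \<in> {a..b}" for t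
      using mult_mono[OF gG[OF t] Fdiff[of b t]] G0 t
      by (simp add: u_def Fab abs_mult mult.assoc)
    have cont\<Phi>: "continuous_on {a..b} (\<lambda>t. \<bar>?\<Phi> t\<bar>)"
      by (intro continuous_on_rabs continuous_on_diff continuous_on_left_primitive
          continuous_on_right_primitive a ab \<alpha> \<rho>)
    have "(\<lambda>t. \<bar>?\<Phi> ((1 - t) * a + b * t)\<bar>) absolutely_integrable_on {0..1}"
    proof (intro absolutely_integrable_continuous_real continuous_on_compose2[OF cont\<Phi>])
      show "(\<lambda>t. (1 - t) * a + b * t) ` {0..1} \<subseteq> {a..b}"
      proof clarify
        fix t :: real assume "t \<in> {0..1}"
        then have "0 \<le> t * (b - a)" "0 \<le> (1 - t) * (b - a)" using ab by auto
        then show "(1 - t) * a + b * t \<in> {a..b}" by (simp add: algebra_simps)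
      qed
    qed (auto intro!: continuous_intros)
    \<comment> \<open>\<open>K\<close> is prescribed only on the unit interval, so it is replaced by
      its formula under the integral before the substitution.\<close>
    moreover have "(LINT t:{0..1}|lebesgue. \<bar>K t\<bar>)
        = (LINT t:{0..1}|lebesgue. \<bar>?\<Phi> ((1 - t) * a + b * t)\<bar>)"
      by (intro set_lebesgue_integral_cong) (use K in auto)
    ultimately have LK: "(b - a) * (LINT t:{0..1}|lebesgue. \<bar>K t\<bar>) = integral {a..b} (\<lambda>t. \<bar>?\<Phi> t\<bar>)"
      using integral_affine_unit_interval[OF ab cont\<Phi>]
      by (simp only: set_lebesgue_integral_eq_integral(2))
    let ?w = "\<lambda>t. katugampola_left_integrand \<rho> \<alpha> (\<lambda>_. 1) b t + katugampola_right_integrand \<rho> \<alpha> (\<lambda>_. 1) a t"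
    have "(F a + F b) / 2 * (katugampola_left \<rho> \<alpha> a g b + katugampola_right \<rho> \<alpha> b g a)
           - (katugampola_left \<rho> \<alpha> a (\<lambda>x. g x * F x) b + katugampola_right \<rho> \<alpha> b (\<lambda>x. g x * F x) a)
        = katugampola_left \<rho> \<alpha> a u b + katugampola_right \<rho> \<alpha> b u a"
    proof -
      \<comment> \<open>Splitting the integral of \<open>u\<close> requires each product with the
        possibly unbounded weight to be integrable; this follows from the existence of the two
        fractional integrals.\<close>
      have wint: "(\<lambda>t. ?w t * h t) integrable_on {a..b}" if "continuous_on {a..b} h" for h
        using integrable_add
          [OF exist(1)[OF that, unfolded katugampola_left_exists_def, THEN set_lebesgue_integral_eq_integral(1)]
              exist(2)[OF that, unfolded katugampola_right_exists_def, THEN set_lebesgue_integral_eq_integral(1)]]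
        by (simp add: katugampola_left_integrand_def[abs_def] katugampola_right_integrand_def[abs_def]
              distrib_right)
      have contgF: "continuous_on {a..b} (\<lambda>x. g x * F x)"
        by (intro continuous_intros contg contF)
      have "integral {a..b} (\<lambda>t. ?w t * u t)
          = integral {a..b} (\<lambda>t. F a * (?w t * g t) - ?w t * (g t * F t))"
        by (simp add: u_def algebra_simps)
      also have "\<dots> = F a * integral {a..b} (\<lambda>t. ?w t * g t) - integral {a..b} (\<lambda>t. ?w t * (g t * F t))"
        by (subst Henstock_Kurzweil_Integration.integral_diff)
           (auto intro!: wint contg contgF integrable_on_mult_right)
      finally show ?thesis
        using Fab by (simp add: katugampola_sum_eq[OF a ab \<alpha> \<rho>] contg contgF contu right_diff_distrib)
    qed
    also have "\<bar>\<dots>\<bar> \<le> G * M / (\<rho> powr \<alpha> * Gamma (\<alpha> + 1)) * integral {a..b} (\<lambda>t. \<bar>?\<Phi> t\<bar>)"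
      using G0 by (intro abs_katugampola_sum_le a ab \<alpha> \<rho> contu ua ub) (auto simp: M_def)
    also have "\<dots> = (b - a) * G / (\<rho> powr \<alpha> * Gamma (\<alpha> + 1)) * M * (LINT t:{0..1}|lebesgue. \<bar>K t\<bar>)"
      unfolding LK[symmetric] by simp
    finally show "\<bar>(F a + F b) / 2 * (katugampola_left \<rho> \<alpha> a g b + katugampola_right \<rho> \<alpha> b g a)
           - (katugampola_left \<rho> \<alpha> a (\<lambda>x. g x * F x) b
              + katugampola_right \<rho> \<alpha> b (\<lambda>x. g x * F x) a)\<bar>
         \<le> (b - a) * (SUP x\<in>{a..b}. \<bar>g x\<bar>) / (\<rho> powr \<alpha> * Gamma (\<alpha> + 1))
            * (\<bar>f' a\<bar> + \<bar>f' b\<bar>) * (LINT t:{0..1}|lebesgue. \<bar>K t\<bar>)"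
      unfolding G_def M_def .
  qed
  with derF intF' show ?thesis by blast
qed

end
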